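(* Let $q=p^r$ with $p$ a prime number and $r$ a positive integer, and let $\omega$ be a primitive element of $\mathbf{F}_q$. Let $A$ be the $(q-1)\times(q-1)$ matrix over the ring $\mathbf{Z}\mathbf{F}_q[X]$ of formal polynomials defined by $$A=\begin{pmatrix} X^{\omega} & X^{\omega^2} & \cdots & X^{\omega^{q-1}}\\ X^{\omega^2} & X^{\omega^3} & \cdots & X^{\omega}\\ \cdots&\cdots&\cdots&\cdots\\ X^{\omega^{q-1}} & X^{\omega} & \cdots & X^{\omega^{q-2}}\end{pmatrix},$$ that is, the $(i,j)$ entry of $A$ is $X^{\omega^{i+j-1}}$ for $1\le i,j\le q-1$. Write $\mathrm{per}(A)=\sum_{i=0}^{q-2}c_iX^{\omega^i}+c_{-1}$ with $c_{-1},c_0,\dots,c_{q-2}\in\mathbf{Z}$. Then the number of solutions $(x_1,\dots,x_{q-1})$ in $\mathbf{F}_q$ of $$x_1+\omega x_2+\omega^2x_3+\cdots+\omega^{q-2}x_{q-1}=0$$ with the restriction that $x_i\neq 0$ for all $i$ and $x_i\ne x_j$ for $i\neq j$ is equal to $c_{-1}$. Hence $$N_q(q-2)=(q-1)!-c_{-1},$$ and also $$c_{-1}+(q-1)c_0=(q-1)!.$$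
   Context: $\mathbf{F}_q$ is the finite field with $q=p^r$ elements; a primitive element is a generator of the cyclic group $\mathbf{F}_q^\times$. A polynomial $f$ over $\mathbf{F}_q$ is a permutation polynomial if the induced map $\alpha\mapsto f(\alpha)$ is a permutation of $\mathbf{F}_q$. $N_q(d)$ denotes the number of permutation polynomials $f$ over $\mathbf{F}_q$ with $\deg f=d$ and $f(0)=0$. $\mathbf{Z}\mathbf{F}_q[X]$ is the set of all functions $\mathbf{F}_q\to\mathbf{Z}$, with pointwise addition, pointwise multiplication by integers, and product $(f\cdot g)(x)=\sum_{u+v=x}f(u)g(v)$ (sum over $u,v\in\mathbf{F}_q$ with $u+v=x$). For $\alpha\in\mathbf{F}_q$, $X^\alpha$ denotes the function with value $1$ at $\alpha$ and $0$ elsewhere, so $X^\alpha X^\beta=X^{\alpha+\beta}$. The elements $X^\alpha$ form a $\mathbf{Z}$-basis of this commutative algebra, and $X^0$ is the multiplicative identity $1$; an integer $c$ is identified with $cX^0$, so $c_{-1}$ is the coefficient of $X^0$. Elements of $\mathbf{Z}\mathbf{F}_q[X]$ are called formal polynomials. The permanent of an $n\times n$ matrix $A=(a_{ij})$ over a commutative ring is $\mathrm{per}(A)=\sum_{\sigma\in S_n}\prod_{i=1}^na_{i\sigma(i)}$.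
   Formalization: The identity N_q(q-2) = (q-1)! - c_{-1} is stated only for q ≠ 2; it fails for q = 2, where c_{-1} = 0 and (q-1)! = 1 but N_2(0) = 0, as no polynomial of degree 0 is a permutation polynomial. *)

theory Defs
  imports
    "HOL-Computational_Algebra.Polynomial"
    "HOL-Combinatorics.Permutations"
    "HOL-Library.Cardinality"
    "HOL-Library.Poly_Mapping"
    "Jordan_Normal_Form.Matrix"
begin

definition primitive_element :: "'a::field \<Rightarrow> bool" where
  "primitive_element \<omega> \<longleftrightarrow> range (\<lambda>k::int. \<omega> powi k) = UNIV - {0}"

definition permutation_poly :: "'a::field poly \<Rightarrow> bool" where
  "permutation_poly f \<longleftrightarrow> bij (poly f)"

definition num_perm_polys :: "'a::{field,finite} itself \<Rightarrow> nat \<Rightarrow> nat" where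
  "num_perm_polys _ d =
     card {f :: 'a poly. permutation_poly f \<and> degree f = d \<and> poly f 0 = 0}"

text \<open>
  For \<open>d = 0\<close> the count is zero. In particular, over the field with two elements it does not
  count the identity map in degree \<open>q - 2 = 0\<close>.
\<close>

lemma num_perm_polys_0: "num_perm_polys TYPE('a::{field,finite}) 0 = 0"
proof -
  have "\<not> (permutation_poly f \<and> degree f = 0 \<and> poly f 0 = 0)" for f :: "'a poly"
  proof
    assume f: "permutation_poly f \<and> degree f = 0 \<and> poly f 0 = 0"
    then obtain a where "f = [:a:]"
      by (auto elim: degree_eq_zeroE)
    then have "poly f 0 = poly f 1"
      by simp
    moreover have "inj (poly f)"
      using f by (simp add: permutation_poly_def bij_def)
    ultimately have "(0::'a) = 1"
      by (simp only: inj_eq)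
    then show False
      by simp
  qed
  then have "{f :: 'a poly. permutation_poly f \<and> degree f = 0 \<and> poly f 0 = 0} = {}"
    by blast
  then show ?thesis
    by (simp only: num_perm_polys_def card.empty)
qed

text \<open>
  For a finite field \<open>'a\<close> every function from \<open>'a\<close> to the integers has finite support, so the
  formal polynomials are the ring \<open>'a \<Rightarrow>\<^sub>0 int\<close>: its addition is pointwise, its
  multiplication is convolution with respect to the addition of \<open>'a\<close>, and \<open>of_int c\<close> is
  \<open>c\<close> times the unit \<open>fmonom 0\<close>.
\<close>

type_synonym 'a formal_poly = "'a \<Rightarrow>\<^sub>0 int"

abbreviation fmonom :: "'a \<Rightarrow> 'a formal_poly" where
  "fmonom \<alpha> \<equiv> Poly_Mapping.single \<alpha> 1"

lemma of_int_formal_poly: "of_int k = (Poly_Mapping.single 0 k :: 'a::comm_monoid_add formal_poly)"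
  by (rule poly_mapping_eqI) (simp add: lookup_of_int lookup_single)

lemma of_int_times_fmonom:
  "of_int k * fmonom \<alpha> = Poly_Mapping.single (\<alpha>::'a::comm_monoid_add) k"
  by (simp add: of_int_formal_poly mult_single)

lemma formal_poly_sum_lookup:
  "f = (\<Sum>\<beta>\<in>UNIV. Poly_Mapping.single (\<beta>::'a::finite) (Poly_Mapping.lookup f \<beta>))"
  by (rule poly_mapping_eqI) (simp add: lookup_sum lookup_single when_def)

lemma primitive_element_bij_betw:
  fixes \<omega> :: "'a::{field,finite}"
  assumes "primitive_element \<omega>"
  shows "bij_betw (\<lambda>i. \<omega> ^ i) {0..<CARD('a) - 1} (UNIV - {0})"
proof -
  define n where "n = CARD('a) - 1"
  have range: "range (\<lambda>k::int. \<omega> powi k) = UNIV - {0}"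
    using assms by (simp add: primitive_element_def)
  have "\<omega> powi 1 \<in> UNIV - {0}"
    unfolding range[symmetric] by blast
  then have nz: "\<omega> \<noteq> 0"
    by simp
  have card: "card (UNIV - {0::'a}) = n"
    by (simp add: n_def)
  have "{0, 1::'a} \<subseteq> UNIV" and "card {0, 1::'a} = 2"
    by auto
  then have "CARD('a) \<ge> 2"
    by (metis card_mono finite)
  then have "n > 0"
    by (simp add: n_def)
  have "bij_betw ((*) \<omega>) (UNIV - {0}) (UNIV - {0})"
    by (rule bij_betwI[where g = "\<lambda>x. x / \<omega>"]) (use nz in auto)
  then have "(\<Prod>x\<in>UNIV - {0}. \<omega> * x) = \<Prod>(UNIV - {0})"
    by (rule prod.reindex_bij_betw)
  then have "\<omega> ^ n * \<Prod>(UNIV - {0}) = \<Prod>(UNIV - {0})"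
    by (simp add: prod.distrib card)
  then have one: "\<omega> ^ n = 1"
    by simp
  have "x \<in> (\<lambda>i. \<omega> ^ i) ` {0..<n}" if "x \<noteq> 0" for x
  proof -
    have "x \<in> range (\<lambda>k::int. \<omega> powi k)"
      unfolding range using that by simp
    then obtain k :: int where k: "x = \<omega> powi k"
      by (rule imageE)
    define m where "m = nat (k mod int n)"
    have m: "int m = k mod int n" "m < n"
      using \<open>n > 0\<close> by (simp_all add: m_def nat_less_iff)
    have "x = \<omega> powi (int n * (k div int n) + int m)"
      by (simp add: k m)
    also have "\<dots> = (\<omega> powi int n) powi (k div int n) * \<omega> powi int m"
      using nz by (simp only: power_int_add power_int_mult simp_thms)
    also have "\<dots> = \<omega> ^ m"
      by (simp add: one)
    finally show ?thesis
      using m by simp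
  qed
  then have image: "(\<lambda>i. \<omega> ^ i) ` {0..<n} = UNIV - {0}"
    using nz by auto
  then have "inj_on (\<lambda>i. \<omega> ^ i) {0..<n}"
    using card by (intro eq_card_imp_inj_on) auto
  with image show ?thesis
    by (simp add: bij_betw_def n_def)
qed

lemma formal_poly_expansion:
  fixes \<omega> :: "'a::{field,finite}" and f :: "'a formal_poly"
  assumes "primitive_element \<omega>"
  shows "\<exists>c::int \<Rightarrow> int.
    f = (\<Sum>i = 0..CARD('a) - 2. of_int (c (int i)) * fmonom (\<omega> ^ i)) + of_int (c (- 1))"
proof -
  define c :: "int \<Rightarrow> int" where
    "c i = (if i = - 1 then Poly_Mapping.lookup f 0 else Poly_Mapping.lookup f (\<omega> ^ nat i))" for i
  have "{0, 1::'a} \<subseteq> UNIV" and "card {0, 1::'a} = 2"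
    by auto
  then have "CARD('a) \<ge> 2"
    by (metis card_mono finite)
  then have set: "{0..CARD('a) - 2} = {0..<CARD('a) - 1}"
    by auto
  have "(\<Sum>i = 0..CARD('a) - 2. of_int (c (int i)) * fmonom (\<omega> ^ i))
      = (\<Sum>\<beta>\<in>UNIV - {0}. Poly_Mapping.single \<beta> (Poly_Mapping.lookup f \<beta>))"
    unfolding set of_int_times_fmonom
    by (subst sum.reindex_bij_betw[OF primitive_element_bij_betw[OF assms], symmetric])
      (simp add: c_def)
  also have "\<dots> + of_int (c (- 1)) = (\<Sum>\<beta>\<in>UNIV. Poly_Mapping.single \<beta> (Poly_Mapping.lookup f \<beta>))"
    by (subst (2) sum.remove[of _ 0]) (simp_all add: c_def of_int_formal_poly add.commute)
  also have "\<dots> = f"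
    by (rule formal_poly_sum_lookup[symmetric])
  finally show ?thesis
    by (intro exI[of _ c]) (rule sym)
qed

text \<open>Meaningful for square matrices only; rows and columns are indexed from 0.\<close>

definition permanent :: "'a::comm_ring_1 mat \<Rightarrow> 'a" where
  "permanent A =
     (\<Sum>\<sigma> | \<sigma> permutes {0..<dim_row A}. \<Prod>i = 0..<dim_row A. A $$ (i, \<sigma> i))"

end

theory Submission
  imports
    Defs
    "HOL-Combinatorics.Multiset_Permutations"
begin

text \<open>
  Write \<open>q\<close> for the cardinality of the field. Let \<open>N y\<close> be the number of ways to arrange the
  \<open>q - 1\<close> nonzero elements as \<open>x\<^sub>0, \<dots>, x\<^bsub>q - 2\<^esub>\<close> so that \<open>\<Sum>i. \<omega>\<^bsup>i\<^esup> * x\<^sub>i = y\<close>. Everything is a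
  statement about these numbers.

  The term of the permanent that belongs to \<open>\<sigma>\<close> is the monomial with exponent
  \<open>\<Sum>i. \<omega>\<^bsup>i + \<sigma> i + 1\<^esup> = \<Sum>i. \<omega>\<^bsup>i\<^esup> * x\<^sub>i\<close> for \<open>x\<^sub>i = \<omega>\<^bsup>\<sigma> i + 1\<^esup>\<close>, and as \<open>\<sigma>\<close> varies, \<open>x\<close> runs once
  through all arrangements. Hence the coefficient of the permanent at \<open>y\<close> is \<open>N y\<close>
  (\<open>lookup_permanent\<close>), so that \<open>c (- 1) = N 0\<close> and \<open>c 0 = N 1\<close>. Multiplying an arrangement by a
  nonzero scalar shows that \<open>N y = N 1\<close> for \<open>y \<noteq> 0\<close>; since there are \<open>(q - 1)!\<close> arrangements
  altogether, \<open>N 0 + (q - 1) * N 1 = (q - 1)!\<close> (\<open>card_distinct_solutions_total\<close>).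

  For the permutation polynomials let \<open>q > 2\<close>. Each permutation \<open>g\<close> of the field that fixes \<open>0\<close>
  comes from exactly one polynomial of degree at most \<open>q - 2\<close>, given explicitly by
  \<open>interpolation_poly\<close>, whose coefficient at \<open>q - 2\<close> is \<open>- (\<Sum>a. a * g a)\<close>. The degree is
  therefore exactly \<open>q - 2\<close> iff this sum is nonzero. Listing the nonzero \<open>a\<close> as powers of \<open>\<omega>\<close>
  turns the sum into \<open>\<Sum>i. \<omega>\<^bsup>i\<^esup> * x\<^sub>i\<close> for the arrangement \<open>x\<^sub>i = g (\<omega>\<^bsup>i\<^esup>)\<close>, so the polynomials of
  degree \<open>q - 2\<close> correspond to the \<open>(q - 1)! - N 0\<close> arrangements with nonzero sum
  (\<open>num_perm_polys_plus_card_distinct_solutions\<close>).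
\<close>

section \<open>Power sums over a finite field\<close>

lemma two_le_card_field: "2 \<le> CARD('a::{field,finite})"
proof -
  have "card {0, 1::'a} \<le> CARD('a)"
    by (rule card_mono) auto
  then show ?thesis by simp
qed

text \<open>Multiplication by \<open>x\<close> permutes the nonzero elements and so preserves their product.\<close>

lemma power_card_minus_one_eq_one:
  fixes x :: "'a::{field,finite}"
  assumes "x \<noteq> 0"
  shows "x ^ (CARD('a) - 1) = 1"
proof -
  have "bij_betw ((*) x) (UNIV - {0}) (UNIV - {0})"
    by (rule bij_betwI[where g = "\<lambda>y. y / x"]) (use assms in auto)
  then have "(\<Prod>y\<in>UNIV - {0}. x * y) = \<Prod>(UNIV - {0})"
    by (rule prod.reindex_bij_betw)
  then have "x ^ (CARD('a) - 1) * \<Prod>(UNIV - {0}) = \<Prod>(UNIV - {0})"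
    by (simp add: prod.distrib)
  then show ?thesis by simp
qed

text \<open>
  This is the orthogonality relation that makes the interpolation formula below work. At
  \<open>x = 1\<close> the sum counts \<open>q - 1 = - 1\<close>; here \<open>q = 0\<close> in the field because translation by \<open>1\<close>
  preserves the sum of all elements while adding \<open>q\<close> to it.
\<close>

lemma geometric_sum_field:
  fixes x :: "'a::{field,finite}"
  assumes "x \<noteq> 0"
  shows "(\<Sum>k<CARD('a) - 1. x ^ k) = (if x = 1 then - 1 else 0)"
proof (cases "x = 1")
  case True
  have "bij_betw (\<lambda>a::'a. a + 1) UNIV UNIV"
    by (rule bij_betwI[where g = "\<lambda>a. a - 1"]) auto
  then have "(\<Sum>a\<in>UNIV. a + 1) = (\<Sum>a\<in>UNIV. a :: 'a)"
    by (rule sum.reindex_bij_betw)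
  then have "(of_nat CARD('a) :: 'a) = 0"
    by (simp add: sum.distrib)
  moreover have "CARD('a) = Suc (CARD('a) - 1)"
    using two_le_card_field[where 'a = 'a] by simp
  ultimately have "1 + (of_nat (CARD('a) - 1) :: 'a) = 0"
    by (metis of_nat_Suc)
  then have "(of_nat (CARD('a) - 1) :: 'a) = - 1"
    by (metis add.inverse_unique)
  then show ?thesis using True by simp
next
  case False
  then show ?thesis
    using power_card_minus_one_eq_one[OF assms] by (simp add: sum_gp_strict)
qed

text \<open>
  Scaling by an element other than \<open>0\<close> and \<open>1\<close> preserves the sum, which must then vanish. In the
  field with two elements there is no such scalar and the sum is \<open>1\<close>.
\<close>

lemma sum_nonzero_eq_0:
  assumes "2 < CARD('a::{field,finite})"
  shows "(\<Sum>x\<in>UNIV - {0::'a}. x) = 0"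
proof -
  have "\<not> (UNIV :: 'a set) \<subseteq> {0, 1}"
  proof
    assume "(UNIV :: 'a set) \<subseteq> {0, 1}"
    then have "CARD('a) \<le> card {0, 1::'a}"
      by (rule card_mono[rotated]) simp
    with assms show False by simp
  qed
  then obtain t :: 'a where t: "t \<noteq> 0" "t \<noteq> 1"
    by auto
  have "bij_betw ((*) t) (UNIV - {0}) (UNIV - {0})"
    by (rule bij_betwI[where g = "\<lambda>y. y / t"]) (use t in auto)
  then have "(\<Sum>x\<in>UNIV - {0}. t * x) = (\<Sum>x\<in>UNIV - {0}. x)"
    by (rule sum.reindex_bij_betw)
  then have "t * (\<Sum>x\<in>UNIV - {0}. x) = (\<Sum>x\<in>UNIV - {0}. x)"
    by (simp add: sum_distrib_left)
  then show ?thesis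
    using t by simp
qed

section \<open>Permutation polynomials of degree \<open>q - 2\<close>\<close>

text \<open>
  Up to sign, the coefficients are the discrete Fourier transform of \<open>g\<close> on the cyclic group of
  nonzero elements. Compared with Lagrange interpolation at all \<open>q\<close> points, this formula omits
  the point \<open>0\<close>; in return the degree is at most \<open>q - 2\<close> and each coefficient is explicit.
\<close>

definition interpolation_poly :: "('a::{field,finite} \<Rightarrow> 'a) \<Rightarrow> 'a poly" where
  "interpolation_poly g =
     (\<Sum>k<CARD('a) - 1. monom (- (\<Sum>a\<in>UNIV - {0}. g a / a ^ k)) k)"

lemma coeff_interpolation_poly:
  fixes g :: "'a::{field,finite} \<Rightarrow> 'a"
  shows "coeff (interpolation_poly g) k =
    (if k < CARD('a) - 1 then - (\<Sum>a\<in>UNIV - {0}. g a / a ^ k) else 0)"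
  by (simp add: interpolation_poly_def coeff_sum)

lemma degree_interpolation_poly_le:
  fixes g :: "'a::{field,finite} \<Rightarrow> 'a"
  shows "degree (interpolation_poly g) \<le> CARD('a) - 2"
  by (rule degree_le) (auto simp: coeff_interpolation_poly)

text \<open>
  Fourier inversion: exchanging the sums leaves for each \<open>a\<close> a geometric sum in \<open>b / a\<close>, which
  picks out \<open>a = b\<close>.
\<close>

lemma poly_interpolation_poly_nonzero:
  fixes g :: "'a::{field,finite} \<Rightarrow> 'a"
  assumes "b \<noteq> 0"
  shows "poly (interpolation_poly g) b = g b"
proof -
  have "poly (interpolation_poly g) b =
      (\<Sum>k<CARD('a) - 1. \<Sum>a\<in>UNIV - {0}. - g a * (b / a) ^ k)"
    by (simp add: interpolation_poly_def poly_sum poly_monom sum_distrib_right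
        sum_negf power_divide)
  also have "\<dots> = (\<Sum>a\<in>UNIV - {0}. - g a * (\<Sum>k<CARD('a) - 1. (b / a) ^ k))"
    by (subst sum.swap) (simp add: sum_distrib_left)
  also have "\<dots> = (\<Sum>a\<in>UNIV - {0}. if a = b then g b else 0)"
  proof (rule sum.cong[OF refl])
    fix a assume a: "a \<in> UNIV - {0::'a}"
    then have "(\<Sum>k<CARD('a) - 1. (b / a) ^ k) = (if b / a = 1 then - 1 else 0)"
      using assms by (intro geometric_sum_field) simp
    then show "- g a * (\<Sum>k<CARD('a) - 1. (b / a) ^ k) = (if a = b then g b else 0)"
      using a by (simp del: One_nat_def)
  qed
  also have "\<dots> = g b"
    using assms by simp
  finally show ?thesis .
qed

lemma poly_interpolation_poly_0:
  fixes g :: "'a::{field,finite} \<Rightarrow> 'a"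
  shows "poly (interpolation_poly g) 0 = - (\<Sum>a\<in>UNIV - {0}. g a)"
  using two_le_card_field[where 'a = 'a]
  by (simp add: poly_0_coeff_0 coeff_interpolation_poly)

text \<open>
  The link between the degree and the linear equation: \<open>a ^ (q - 2)\<close> is the inverse of \<open>a\<close>, so
  dividing by it multiplies by \<open>a\<close>.
\<close>

lemma coeff_interpolation_poly_top:
  fixes g :: "'a::{field,finite} \<Rightarrow> 'a"
  shows "coeff (interpolation_poly g) (CARD('a) - 2) = - (\<Sum>a\<in>UNIV - {0}. a * g a)"
proof -
  have exponent: "CARD('a) - 1 = Suc (CARD('a) - 2)"
    using two_le_card_field[where 'a = 'a] by simp
  have "g a / a ^ (CARD('a) - 2) = a * g a" if "a \<noteq> 0" for a
    using power_card_minus_one_eq_one[OF that] that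
    unfolding exponent by (simp add: field_simps)
  then show ?thesis
    using exponent by (simp add: coeff_interpolation_poly)
qed

lemma permutes_nonzero_iff:
  fixes g :: "'a::zero \<Rightarrow> 'a"
  shows "g permutes (UNIV - {0}) \<longleftrightarrow> bij g \<and> g 0 = 0"
  by (auto simp: permutes_def bij_iff)

text \<open>
  At \<open>0\<close> the interpolation gives minus the sum of the values at nonzero points. For a
  permutation that is the sum of all nonzero elements, so the value at \<open>0\<close> is correct as well.
\<close>

lemma interpolation_poly_permutes:
  fixes g :: "'a::{field,finite} \<Rightarrow> 'a"
  assumes "2 < CARD('a)" and g: "g permutes (UNIV - {0})"
  shows "poly (interpolation_poly g) = g"
proof
  fix b
  have "(\<Sum>a\<in>UNIV - {0}. g a) = 0"
    using sum.permute[OF g, of "\<lambda>x. x"] sum_nonzero_eq_0[OF assms(1)] by (simp add: o_def)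
  moreover have "g 0 = 0"
    using g by (simp add: permutes_nonzero_iff)
  ultimately show "poly (interpolation_poly g) b = g b"
    by (cases "b = 0") (simp_all add: poly_interpolation_poly_0 poly_interpolation_poly_nonzero)
qed

lemma interpolation_poly_of_poly:
  fixes f :: "'a::{field,finite} poly"
  assumes "2 < CARD('a)" and "poly f permutes (UNIV - {0})" and "degree f \<le> CARD('a) - 2"
  shows "interpolation_poly (poly f) = f"
proof (rule poly_eqI_degree[where A = UNIV])
  show "poly (interpolation_poly (poly f)) x = poly f x" for x
    by (simp add: interpolation_poly_permutes assms)
  show "degree (interpolation_poly (poly f)) < CARD('a)"
    using degree_interpolation_poly_le[of "poly f"] assms(1) by linarith
  show "degree f < CARD('a)"
    using assms by linarith
qed

text \<open>
  For \<open>q = 2\<close> this would fail: the zero polynomial has degree \<open>0 = q - 2\<close> although its coefficient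
  there vanishes.
\<close>

lemma degree_interpolation_poly_eq_iff:
  fixes g :: "'a::{field,finite} \<Rightarrow> 'a"
  assumes "2 < CARD('a)"
  shows "degree (interpolation_poly g) = CARD('a) - 2 \<longleftrightarrow> (\<Sum>a\<in>UNIV - {0}. a * g a) \<noteq> 0"
proof -
  have "degree (interpolation_poly g) = CARD('a) - 2 \<longleftrightarrow>
      coeff (interpolation_poly g) (CARD('a) - 2) \<noteq> 0"
  proof
    assume deg: "degree (interpolation_poly g) = CARD('a) - 2"
    then have "interpolation_poly g \<noteq> 0"
      using assms by auto
    then show "coeff (interpolation_poly g) (CARD('a) - 2) \<noteq> 0"
      by (simp flip: deg)
  next
    assume "coeff (interpolation_poly g) (CARD('a) - 2) \<noteq> 0"
    then show "degree (interpolation_poly g) = CARD('a) - 2"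
      by (intro antisym degree_interpolation_poly_le le_degree)
  qed
  then show ?thesis
    by (simp add: coeff_interpolation_poly_top)
qed

lemma num_perm_polys_eq_card_permutes:
  assumes "2 < CARD('a::{field,finite})"
  shows "num_perm_polys TYPE('a) (CARD('a) - 2) =
    card {g :: 'a \<Rightarrow> 'a. g permutes (UNIV - {0}) \<and> (\<Sum>a\<in>UNIV - {0}. a * g a) \<noteq> 0}"
    (is "_ = card ?G")
proof -
  let ?F = "{f :: 'a poly. permutation_poly f \<and> degree f = CARD('a) - 2 \<and> poly f 0 = 0}"
  have F: "f \<in> ?F \<longleftrightarrow> poly f permutes (UNIV - {0}) \<and> degree f = CARD('a) - 2" for f
    by (auto simp: permutation_poly_def permutes_nonzero_iff)
  have "bij_betw poly ?F ?G"
  proof (rule bij_betwI[where g = interpolation_poly])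
    show "poly \<in> ?F \<rightarrow> ?G"
    proof
      fix f assume "f \<in> ?F"
      then have f: "poly f permutes (UNIV - {0})" "degree f = CARD('a) - 2"
        unfolding F by auto
      have "interpolation_poly (poly f) = f"
        by (rule interpolation_poly_of_poly) (use assms f in auto)
      with f show "poly f \<in> ?G"
        using degree_interpolation_poly_eq_iff[OF assms, of "poly f"] by simp
    qed
    show "interpolation_poly \<in> ?G \<rightarrow> ?F"
      using assms degree_interpolation_poly_eq_iff[OF assms]
      unfolding Pi_iff F by (auto simp: interpolation_poly_permutes)
    show "interpolation_poly (poly f) = f" if "f \<in> ?F" for f
      using that assms unfolding F by (intro interpolation_poly_of_poly) auto
    show "poly (interpolation_poly g) = g" if "g \<in> ?G" for g
      using that assms by (intro interpolation_poly_permutes) auto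
  qed
  then show ?thesis
    unfolding num_perm_polys_def by (rule bij_betw_same_card)
qed

section \<open>Permutations as lists of distinct values\<close>

text \<open>
  Reading off a permutation \<open>g\<close> through an enumeration \<open>e\<close> of its domain and a relabelling \<open>h\<close> of
  its values. With \<open>h\<close> the identity it lists the values of a permutation of the nonzero field
  elements at the powers of \<open>\<omega>\<close>; with \<open>e\<close> the identity it translates the index permutations of
  the permanent. Both sides have \<open>(card T)!\<close> elements, so injectivity suffices.
\<close>

lemma bij_betw_permutes_permutations_of_set:
  fixes e :: "nat \<Rightarrow> 'b" and h :: "'b \<Rightarrow> 'c"
  assumes e: "bij_betw e {0..<n} S" and h: "bij_betw h S T"
  shows "bij_betw (\<lambda>g. map (\<lambda>i. h (g (e i))) [0..<n]) {g. g permutes S} (permutations_of_set T)"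
    (is "bij_betw ?l ?P ?L")
proof -
  have fin: "finite S" "finite T" and card: "card S = card T"
    using bij_betw_finite[OF e] bij_betw_finite[OF h] bij_betw_same_card[OF h] by simp_all
  have inj: "inj_on ?l ?P"
  proof (rule inj_onI)
    fix g g' assume g: "g \<in> ?P" "g' \<in> ?P" and eq: "?l g = ?l g'"
    show "g = g'"
    proof
      fix x
      show "g x = g' x"
      proof (cases "x \<in> S")
        case True
        then obtain i where i: "i < n" "x = e i"
          using e by (auto simp: bij_betw_def)
        have "?l g ! i = ?l g' ! i"
          by (simp only: eq)
        then have "h (g x) = h (g' x)"
          using i by simp
        then show ?thesis
          using h True g by (auto simp: bij_betw_def permutes_in_image dest: inj_onD)
      next
        case False
        then show ?thesis
          using g by (auto simp: permutes_def)
      qed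
    qed
  qed
  have sub: "?l ` ?P \<subseteq> ?L"
  proof clarify
    fix g assume g: "g permutes S"
    have "bij_betw (h \<circ> (g \<circ> e)) {0..<n} T"
      using e permutes_imp_bij[OF g] h by (blast intro: bij_betw_trans)
    then show "?l g \<in> ?L"
      by (auto simp: permutations_of_set_def bij_betw_def distinct_map o_def)
  qed
  have "card (?l ` ?P) = card ?L"
    using card_image[OF inj] card_permutations[OF refl fin(1)] fin card by simp
  then have "?l ` ?P = ?L"
    using sub fin(2) by (intro card_subset_eq) auto
  with inj show ?thesis
    by (simp add: bij_betw_def)
qed

lemma bij_betw_card_Collect:
  assumes "bij_betw u {x. P x} B" and "\<And>x. P x \<Longrightarrow> R (u x) \<longleftrightarrow> Q x"
  shows "card {x. P x \<and> Q x} = card {y \<in> B. R y}"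
proof -
  have "bij_betw u {x \<in> {x. P x}. Q x} {y \<in> B. R y}"
    using assms by (auto simp: bij_betw_def inj_on_def)
  then show ?thesis
    using bij_betw_same_card by fastforce
qed

section \<open>Distinct solutions and the permanent\<close>

text \<open>
  The unknowns are pairwise distinct and nonzero, and there are as many of them as there are
  nonzero elements, so a solution is an arrangement of all nonzero elements.
\<close>

definition distinct_solutions :: "'a::{field,finite} \<Rightarrow> 'a \<Rightarrow> 'a list set" where
  "distinct_solutions \<omega> y = {xs \<in> permutations_of_set (UNIV - {0}).
     (\<Sum>i = 0..<CARD('a) - 1. \<omega> ^ i * xs ! i) = y}"

lemma finite_distinct_solutions [simp]: "finite (distinct_solutions \<omega> y)"
  by (simp add: distinct_solutions_def)

lemma length_permutation_nonzero:
  fixes xs :: "'a::{field,finite} list"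
  assumes "xs \<in> permutations_of_set (UNIV - {0})"
  shows "length xs = CARD('a) - 1"
  using length_finite_permutations_of_set[OF assms] by simp

lemma distinct_solutions_altdef:
  fixes \<omega> y :: "'a::{field,finite}"
  shows "distinct_solutions \<omega> y = {xs. length xs = CARD('a) - 1
    \<and> (\<Sum>i = 0..<CARD('a) - 1. \<omega> ^ i * xs ! i) = y
    \<and> (\<forall>i < CARD('a) - 1. xs ! i \<noteq> 0)
    \<and> (\<forall>i < CARD('a) - 1. \<forall>j < CARD('a) - 1. i \<noteq> j \<longrightarrow> xs ! i \<noteq> xs ! j)}"
proof -
  have "xs \<in> permutations_of_set (UNIV - {0}) \<longleftrightarrow>
      length xs = CARD('a) - 1 \<and> 0 \<notin> set xs \<and> distinct xs" for xs :: "'a list"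
  proof
    assume "xs \<in> permutations_of_set (UNIV - {0})"
    then show "length xs = CARD('a) - 1 \<and> 0 \<notin> set xs \<and> distinct xs"
      using length_permutation_nonzero by (auto simp: permutations_of_set_def)
  next
    assume xs: "length xs = CARD('a) - 1 \<and> 0 \<notin> set xs \<and> distinct xs"
    then have "set xs = UNIV - {0}"
      by (intro card_subset_eq) (auto simp: distinct_card)
    with xs show "xs \<in> permutations_of_set (UNIV - {0})"
      by (simp add: permutations_of_set_def)
  qed
  then show ?thesis
    by (auto simp: distinct_solutions_def distinct_conv_nth in_set_conv_nth)
qed

text \<open>Scaling by \<open>inverse y\<close> matches the solutions for \<open>y\<close> with those for \<open>1\<close>.\<close>

lemma card_distinct_solutions_scale:
  fixes \<omega> y :: "'a::{field,finite}"
  assumes "y \<noteq> 0"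
  shows "card (distinct_solutions \<omega> y) = card (distinct_solutions \<omega> 1)"
proof -
  have scale: "map ((*) t) xs \<in> distinct_solutions \<omega> (t * s)"
    if "t \<noteq> 0" "xs \<in> distinct_solutions \<omega> s" for t s :: 'a and xs
  proof -
    have "length xs = CARD('a) - 1"
      using that by (simp add: distinct_solutions_altdef)
    then have "(\<Sum>i = 0..<CARD('a) - 1. \<omega> ^ i * map ((*) t) xs ! i) =
        t * (\<Sum>i = 0..<CARD('a) - 1. \<omega> ^ i * xs ! i)"
      by (simp add: sum_distrib_left mult.left_commute)
    then show ?thesis
      using that by (simp add: distinct_solutions_altdef)
  qed
  have "bij_betw (map ((*) (inverse y))) (distinct_solutions \<omega> y) (distinct_solutions \<omega> 1)"
  proof (rule bij_betwI[where g = "map ((*) y)"])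
    show "map ((*) (inverse y)) \<in> distinct_solutions \<omega> y \<rightarrow> distinct_solutions \<omega> 1"
      using scale[of "inverse y" _ y] assms by auto
    show "map ((*) y) \<in> distinct_solutions \<omega> 1 \<rightarrow> distinct_solutions \<omega> y"
      using scale[of y _ 1] assms by auto
  qed (use assms in \<open>simp_all add: o_def flip: mult.assoc\<close>)
  then show ?thesis
    by (rule bij_betw_same_card)
qed

lemma card_permutations_nonzero:
  "card (permutations_of_set (UNIV - {0::'a::{field,finite}})) = fact (CARD('a) - 1)"
  by simp

text \<open>Every arrangement of the nonzero elements solves the equation for exactly one right-hand side.\<close>

lemma card_distinct_solutions_total:
  fixes \<omega> :: "'a::{field,finite}"
  shows "card (distinct_solutions \<omega> 0) + (CARD('a) - 1) * card (distinct_solutions \<omega> 1)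
    = fact (CARD('a) - 1)"
proof -
  have "fact (CARD('a) - 1) = card (\<Union>y. distinct_solutions \<omega> y)"
  proof -
    have "(\<Union>y. distinct_solutions \<omega> y) = permutations_of_set (UNIV - {0})"
      by (auto simp: distinct_solutions_def)
    then show ?thesis
      by (simp only: card_permutations_nonzero)
  qed
  also have "\<dots> = (\<Sum>y\<in>UNIV. card (distinct_solutions \<omega> y))"
    by (rule card_UN_disjoint) (auto simp: distinct_solutions_def)
  also have "\<dots> = card (distinct_solutions \<omega> 0) + (\<Sum>y\<in>UNIV - {0}. card (distinct_solutions \<omega> y))"
    by (rule sum.remove) auto
  also have "(\<Sum>y\<in>UNIV - {0}. card (distinct_solutions \<omega> y)) =
      (\<Sum>y\<in>UNIV - {0::'a}. card (distinct_solutions \<omega> 1))"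
    by (rule sum.cong) (auto intro: card_distinct_solutions_scale)
  finally show ?thesis
    by simp
qed

text \<open>
  A permutation polynomial is determined by its values at \<open>\<omega>\<^bsup>0\<^esup>, \<omega>\<^bsup>1\<^esup>, \<dots>\<close>, and the criterion for
  degree \<open>q - 2\<close> says that these values do not solve the homogeneous equation.
\<close>

lemma num_perm_polys_plus_card_distinct_solutions:
  fixes \<omega> :: "'a::{field,finite}"
  assumes "2 < CARD('a)" and \<omega>: "primitive_element \<omega>"
  shows "num_perm_polys TYPE('a) (CARD('a) - 2) + card (distinct_solutions \<omega> 0)
    = fact (CARD('a) - 1)"
proof -
  define n where "n = CARD('a) - 1"
  note powers = primitive_element_bij_betw[OF \<omega>, folded n_def]
  let ?L = "permutations_of_set (UNIV - {0::'a})"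
  have "num_perm_polys TYPE('a) (CARD('a) - 2) =
      card {xs \<in> ?L. (\<Sum>i = 0..<n. \<omega> ^ i * xs ! i) \<noteq> 0}"
    unfolding num_perm_polys_eq_card_permutes[OF assms(1)]
  proof (rule bij_betw_card_Collect)
    show "bij_betw (\<lambda>g. map (\<lambda>i. g (\<omega> ^ i)) [0..<n]) {g. g permutes (UNIV - {0})} ?L"
      using bij_betw_permutes_permutations_of_set[OF powers bij_betw_id] by simp
    show "(\<Sum>i = 0..<n. \<omega> ^ i * map (\<lambda>i. g (\<omega> ^ i)) [0..<n] ! i) \<noteq> 0 \<longleftrightarrow>
        (\<Sum>a\<in>UNIV - {0}. a * g a) \<noteq> 0" for g
      by (simp flip: sum.reindex_bij_betw[OF powers])
  qed
  also have "{xs \<in> ?L. (\<Sum>i = 0..<n. \<omega> ^ i * xs ! i) \<noteq> 0} = ?L - distinct_solutions \<omega> 0"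
    by (auto simp: distinct_solutions_def n_def)
  finally have "num_perm_polys TYPE('a) (CARD('a) - 2) = card (?L - distinct_solutions \<omega> 0)" .
  moreover have "distinct_solutions \<omega> 0 \<subseteq> ?L"
    by (auto simp: distinct_solutions_def)
  then have "card (?L - distinct_solutions \<omega> 0) + card (distinct_solutions \<omega> 0) = card ?L"
    by (simp add: card_Diff_subset card_mono del: card_permutations_of_set)
  ultimately show ?thesis
    by simp
qed

lemma prod_fmonom:
  fixes f :: "'b \<Rightarrow> 'a::comm_monoid_add"
  shows "(\<Prod>i\<in>I. fmonom (f i)) = fmonom (\<Sum>i\<in>I. f i)"
  by (induction I rule: infinite_finite_induct) (simp_all add: mult_single)

text \<open>
  Each \<open>\<sigma>\<close> contributes one monomial, whose exponent \<open>\<Sum>i. \<omega>\<^bsup>i\<^esup> * \<omega>\<^bsup>\<sigma> i + 1\<^esup>\<close> is the left-hand side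
  of the equation at the arrangement with entries \<open>\<omega>\<^bsup>\<sigma> i + 1\<^esup>\<close>.
\<close>

lemma lookup_permanent:
  fixes \<omega> :: "'a::{field,finite}"
  assumes \<omega>: "primitive_element \<omega>"
    and A: "A = mat (CARD('a) - 1) (CARD('a) - 1) (\<lambda>(i, j). fmonom (\<omega> ^ (i + j + 1)))"
  shows "Poly_Mapping.lookup (permanent A) y = int (card (distinct_solutions \<omega> y))"
proof -
  define n where "n = CARD('a) - 1"
  define exponent where "exponent \<sigma> = (\<Sum>i = 0..<n. \<omega> ^ (i + \<sigma> i + 1))" for \<sigma> :: "nat \<Rightarrow> nat"
  have "(\<Prod>i = 0..<n. A $$ (i, \<sigma> i)) = fmonom (exponent \<sigma>)" if "\<sigma> permutes {0..<n}" for \<sigma>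
  proof -
    have "\<sigma> i < n" if "i < n" for i
      using permutes_in_image[OF \<open>\<sigma> permutes {0..<n}\<close>, of i] that by simp
    then have "(\<Prod>i = 0..<n. A $$ (i, \<sigma> i)) = (\<Prod>i = 0..<n. fmonom (\<omega> ^ (i + \<sigma> i + 1)))"
      by (intro prod.cong) (simp_all add: A n_def)
    then show ?thesis
      by (simp only: exponent_def prod_fmonom)
  qed
  moreover have "dim_row A = n"
    by (simp add: A n_def)
  ultimately have "permanent A = (\<Sum>\<sigma> | \<sigma> permutes {0..<n}. fmonom (exponent \<sigma>))"
    by (simp add: permanent_def)
  then have "Poly_Mapping.lookup (permanent A) y =
      (\<Sum>\<sigma> | \<sigma> permutes {0..<n}. if exponent \<sigma> = y then 1 else 0)"
    by (simp only: lookup_sum lookup_single when_def)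
  also have "\<dots> = int (card {\<sigma>. \<sigma> permutes {0..<n} \<and> exponent \<sigma> = y})"
    using sum.inter_filter[of "{\<sigma>. \<sigma> permutes {0..<n}}" "\<lambda>_. 1 :: int" "\<lambda>\<sigma>. exponent \<sigma> = y"]
    by (simp add: finite_permutations)
  also have "card {\<sigma>. \<sigma> permutes {0..<n} \<and> exponent \<sigma> = y} = card (distinct_solutions \<omega> y)"
    unfolding distinct_solutions_def n_def[symmetric]
  proof (rule bij_betw_card_Collect)
    note powers = primitive_element_bij_betw[OF \<omega>, folded n_def]
    have "\<omega> powi 1 \<in> range (\<lambda>k::int. \<omega> powi k)"
      by (rule rangeI)
    then have "\<omega> \<noteq> 0"
      using \<omega> by (simp add: primitive_element_def del: rangeI)
    then have "bij_betw ((*) \<omega>) (UNIV - {0}) (UNIV - {0})"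
      by (intro bij_betwI[where g = "\<lambda>x. x / \<omega>"]) auto
    then have "bij_betw (\<lambda>i. \<omega> ^ (i + 1)) {0..<n} (UNIV - {0})"
      using bij_betw_trans[OF powers] by (simp add: o_def)
    from bij_betw_permutes_permutations_of_set[OF bij_betw_id this]
    show "bij_betw (\<lambda>\<sigma>. map (\<lambda>i. \<omega> ^ (\<sigma> i + 1)) [0..<n]) {\<sigma>. \<sigma> permutes {0..<n}}
        (permutations_of_set (UNIV - {0}))"
      by (simp only: id_apply)
    show "(\<Sum>i = 0..<n. \<omega> ^ i * map (\<lambda>i. \<omega> ^ (\<sigma> i + 1)) [0..<n] ! i) = y \<longleftrightarrow> exponent \<sigma> = y" for \<sigma>
      by (simp add: exponent_def power_add mult.left_commute)
  qed
  finally show ?thesis .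
qed

lemma lookup_power_expansion:
  fixes \<omega> :: "'a::{field,finite}" and c :: "int \<Rightarrow> int"
  assumes \<omega>: "primitive_element \<omega>"
    and f: "f = (\<Sum>i = 0..CARD('a) - 2. of_int (c (int i)) * fmonom (\<omega> ^ i)) + of_int (c (- 1))"
  shows "Poly_Mapping.lookup f 0 = c (- 1)" and "Poly_Mapping.lookup f 1 = c 0"
proof -
  have powers: "bij_betw (\<lambda>i. \<omega> ^ i) {0..CARD('a) - 2} (UNIV - {0})"
  proof -
    have "{0..CARD('a) - 2} = {0..<CARD('a) - 1}"
      using two_le_card_field[where 'a = 'a] by auto
    then show ?thesis
      using primitive_element_bij_betw[OF \<omega>] by simp
  qed
  have lookup: "Poly_Mapping.lookup f y =
      (\<Sum>i = 0..CARD('a) - 2. if \<omega> ^ i = y then c (int i) else 0) + (if y = 0 then c (- 1) else 0)"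
    for y
    by (simp add: f of_int_times_fmonom of_int_formal_poly[where k = "c (- 1)"] lookup_add lookup_sum
        lookup_single when_def)
  have "\<omega> ^ i \<noteq> 0" if "i \<in> {0..CARD('a) - 2}" for i
    using bij_betwE[OF powers] that by blast
  then have "(\<Sum>i = 0..CARD('a) - 2. if \<omega> ^ i = 0 then c (int i) else 0) = 0"
    by (intro sum.neutral) (meson if_not_P)
  then show "Poly_Mapping.lookup f 0 = c (- 1)"
    unfolding lookup by (simp del: power_eq_0_iff)
  have "\<omega> ^ i = 1 \<longleftrightarrow> i = 0" if "i \<in> {0..CARD('a) - 2}" for i
    using inj_onD[OF bij_betw_imp_inj_on[OF powers], of i 0] that by auto
  then have "(\<Sum>i = 0..CARD('a) - 2. if \<omega> ^ i = 1 then c (int i) else 0) =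
      (\<Sum>i = 0..CARD('a) - 2. if i = 0 then c (int i) else 0)"
    by (intro sum.cong) auto
  then show "Poly_Mapping.lookup f 1 = c 0"
    unfolding lookup by simp
qed

theorem theorem2p1:
  fixes p r q :: nat
    and \<omega> :: "'a::{field,finite}"
    and A :: "'a formal_poly mat"
    and c :: "int \<Rightarrow> int"
  assumes "prime p" and "r > 0" and "q = p ^ r" and "CARD('a) = q"
    and "primitive_element \<omega>"
    and "A = mat (q - 1) (q - 1) (\<lambda>(i, j). fmonom (\<omega> ^ (i + j + 1)))"
    and "permanent A = (\<Sum>i = 0..q - 2. of_int (c (int i)) * fmonom (\<omega> ^ i)) + of_int (c (- 1))"
  shows "int (card {xs :: 'a list. length xs = q - 1
            \<and> (\<Sum>i = 0..<q - 1. \<omega> ^ i * xs ! i) = 0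
            \<and> (\<forall>i < q - 1. xs ! i \<noteq> 0)
            \<and> (\<forall>i < q - 1. \<forall>j < q - 1. i \<noteq> j \<longrightarrow> xs ! i \<noteq> xs ! j)}) = c (- 1)
    \<and> (q \<noteq> 2 \<longrightarrow> int (num_perm_polys TYPE('a) (q - 2)) = fact (q - 1) - c (- 1))
    \<and> c (- 1) + int (q - 1) * c 0 = fact (q - 1)"
proof -
  note q = \<open>CARD('a) = q\<close>
  note \<omega> = \<open>primitive_element \<omega>\<close>
  note lookup_A = lookup_permanent[OF \<omega>, unfolded q, OF assms(6)]
  note lookup_c = lookup_power_expansion[OF \<omega>, unfolded q, OF assms(7)]
  have c: "c (- 1) = int (card (distinct_solutions \<omega> 0))" "c 0 = int (card (distinct_solutions \<omega> 1))"
    using lookup_A lookup_c by simp_all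
  have "int (num_perm_polys TYPE('a) (q - 2)) = fact (q - 1) - c (- 1)" if "q \<noteq> 2"
  proof -
    have "2 < CARD('a)"
      using two_le_card_field[where 'a = 'a] that q by simp
    from num_perm_polys_plus_card_distinct_solutions[OF this \<omega>]
    have "int (num_perm_polys TYPE('a) (q - 2) + card (distinct_solutions \<omega> 0)) = fact (q - 1)"
      by (simp only: q of_nat_fact)
    then show ?thesis
      by (simp add: c)
  qed
  moreover have "c (- 1) + int (q - 1) * c 0 = fact (q - 1)"
  proof -
    have "int (card (distinct_solutions \<omega> 0) + (q - 1) * card (distinct_solutions \<omega> 1)) = fact (q - 1)"
      by (simp only: card_distinct_solutions_total[of \<omega>, unfolded q] of_nat_fact)
    then show ?thesis
      by (simp only: c of_nat_add of_nat_mult)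
  qed
  ultimately show ?thesis
    by (simp add: c distinct_solutions_altdef q)
qed

end
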